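(* If $k_f>0$, then the system $I\ddot q=-k_f\dot q+\tau(q)$ on the cylinder $\mathbb{S}\times\mathbb{R}$ (with $\tau$ the Stirling-engine torque function defined in the context) has at most one non-contractible limit cycle. If such a limit cycle exists, it is sign definite, with its sign opposite to the sign of $\lim_{q\to2\pi^-}U(q)$, where $U(q)=-\int_0^q\tau(s)\,\mathrm{d}s$.
   Context: Alpha Stirling engine model. Constants: $I>0$ (moment of inertia), $k_f\in\mathbb{R}$ (friction coefficient), $N,R,T_h,T_c,p_a>0$ (amount of gas, gas constant, hot and cold temperatures, ambient pressure), $A_1,A_2>0$ (piston areas), $0<r<l$ (crank radius and rod length), $V_{1,\max},V_{2,\max}$ (maximal cylinder volumes) with $V_{i,\max}>2rA_i$ (so that all volumes below are positive), and phase shift $\alpha\in[0,2\pi)$. Let $x_2(q)=-r\cos q+\sqrt{l^2-r^2\sin^2 q}$, $x_1(q)=x_2(q-\alpha)$, $V_i(q)=V_{i,\max}-A_i\,(x_i(q)-(l-r))$ for $i=1,2$, $$p(q)=\frac{NR}{\frac{V_1(q)}{T_h}+\frac{V_2(q)}{T_c}},\qquad \phi(q)=r\sin q-r^2\frac{\sin q\cos q}{\sqrt{l^2-r^2\sin^2 q}},$$ $$\tau(q)=-\big(A_1\phi(q-\alpha)+A_2\phi(q)\big)\,(p(q)-p_a).$$ The function $\tau$ is smooth and $2\pi$-periodic. The potential $U(q)=-\int_0^q\tau(s)\,\mathrm{d}s$ is a smooth function on $\mathbb{R}$, in general not $2\pi$-periodic. The system is $I\ddot q=-k_f\dot q+\tau(q)$,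 with state $(z_1,z_2)=(q,\dot q)\in\mathbb{S}\times\mathbb{R}$, where $\mathbb{S}=\mathbb{R}/2\pi\mathbb{Z}$. A limit cycle is, as usual, an isolated nonconstant periodic orbit (limit cycles are counted as orbits, i.e. as subsets of the state space); it is parametrized by a solution $\Gamma:[0,T]\to\mathbb{S}\times\mathbb{R}$, injective on $[0,T)$, with $\Gamma(0)=\Gamma(T)$, $T>0$. It is called contractible (or oscillatory) if it is homotopic, as a closed curve, to a point $\gamma\in\mathbb{S}\times\mathbb{R}$: there is a continuous $h:[0,T]\times[0,1]\to\mathbb{S}\times\mathbb{R}$ with $h(t,0)=\Gamma(t)$ and $h(t,1)=\gamma$ for all $t\in[0,T]$, and $h(0,s)=h(T,s)$ for all $s\in[0,1]$. Otherwise it is called non-contractible (or rotational). A non-contractible limit cycle, written as a graph $z_2=z_2^*(z_1)$ over $z_1\in\mathbb{S}$, is sign definite if either $z_2^*(z_1)>0$ for all $z_1\in[0,2\pi)$ (positive sign) or $z_2^*(z_1)<0$ for all $z_1\in[0,2\pi)$ (negative sign); equivalently, $z_2=\dot q$ is strictly positive at all points of the orbit, or strictly negative at all points of the orbit. *)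

theory Defs
  imports "HOL-Analysis.Analysis"
begin

record engine =
  inertia :: real
  friction :: real
  gas_amount :: real
  gas_const :: real
  temp_hot :: real
  temp_cold :: real
  pres_amb :: real
  area1 :: real
  area2 :: real
  crank :: real
  rod :: real
  vmax1 :: real
  vmax2 :: real
  phase :: real

text \<open>The sign of the friction coefficient is deliberately left unconstrained.\<close>

definition alpha_stirling :: "engine \<Rightarrow> bool" where
  "alpha_stirling E \<longleftrightarrow>
     inertia E > 0 \<and> gas_amount E > 0 \<and> gas_const E > 0 \<and> temp_hot E > 0 \<and> temp_cold E > 0 \<and>
     pres_amb E > 0 \<and> area1 E > 0 \<and> area2 E > 0 \<and> 0 < crank E \<and> crank E < rod E \<and>
     vmax1 E > 2 * crank E * area1 E \<and> vmax2 E > 2 * crank E * area2 E \<and>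
     0 \<le> phase E \<and> phase E < 2 * pi"

definition pos2 :: "engine \<Rightarrow> real \<Rightarrow> real" where
  "pos2 E q = - crank E * cos q + sqrt ((rod E)\<^sup>2 - (crank E)\<^sup>2 * (sin q)\<^sup>2)"

definition pos1 :: "engine \<Rightarrow> real \<Rightarrow> real" where
  "pos1 E q = pos2 E (q - phase E)"

definition vol1 :: "engine \<Rightarrow> real \<Rightarrow> real" where
  "vol1 E q = vmax1 E - area1 E * (pos1 E q - (rod E - crank E))"

definition vol2 :: "engine \<Rightarrow> real \<Rightarrow> real" where
  "vol2 E q = vmax2 E - area2 E * (pos2 E q - (rod E - crank E))"

definition pressure :: "engine \<Rightarrow> real \<Rightarrow> real" where
  "pressure E q =
     gas_amount E * gas_const E / (vol1 E q / temp_hot E + vol2 E q / temp_cold E)"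

definition phi :: "engine \<Rightarrow> real \<Rightarrow> real" where
  "phi E q = crank E * sin q
     - (crank E)\<^sup>2 * (sin q * cos q / sqrt ((rod E)\<^sup>2 - (crank E)\<^sup>2 * (sin q)\<^sup>2))"

definition torque :: "engine \<Rightarrow> real \<Rightarrow> real" where
  "torque E q =
     - (area1 E * phi E (q - phase E) + area2 E * phi E q) * (pressure E q - pres_amb E)"

text \<open>The interval integral is oriented, so this is the intended function for negative
  arguments as well.\<close>

definition potential :: "engine \<Rightarrow> real \<Rightarrow> real" where
  "potential E q = - (LBINT s=ereal 0..ereal q. torque E s)"

text \<open>The circle of angles modulo \<open>2 * pi\<close> is realised as the unit circle in the complex
  plane, the class of the angle \<open>q\<close> being \<open>cis q\<close>.\<close>

definition cylinder :: "(complex \<times> real) set" where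
  "cylinder = sphere 0 1 \<times> UNIV"

text \<open>A curve on the cylinder is a solution if it is the projection of a solution
  \<open>(q, q')\<close> of the second-order equation with a real-valued angle \<open>q\<close>.\<close>

definition solution_on :: "engine \<Rightarrow> real set \<Rightarrow> (real \<Rightarrow> complex \<times> real) \<Rightarrow> bool" where
  "solution_on E J \<Gamma> \<longleftrightarrow> (\<exists>q v a. \<forall>t\<in>J.
     \<Gamma> t = (cis (q t), v t) \<and>
     (q has_real_derivative v t) (at t within J) \<and>
     (v has_real_derivative a t) (at t within J) \<and>
     inertia E * a t = - friction E * v t + torque E (q t))"

definition parametrizes ::
  "engine \<Rightarrow> (real \<Rightarrow> complex \<times> real) \<Rightarrow> real \<Rightarrow> (complex \<times> real) set \<Rightarrow> bool" where
  "parametrizes E \<Gamma> T C \<longleftrightarrow>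
     T > 0 \<and> solution_on E {0..T} \<Gamma> \<and> inj_on \<Gamma> {0..<T} \<and> \<Gamma> 0 = \<Gamma> T \<and> C = \<Gamma> ` {0..T}"

text \<open>Nonconstancy is implied by injectivity on \<open>{0..<T}\<close>.\<close>

definition periodic_orbit :: "engine \<Rightarrow> (complex \<times> real) set \<Rightarrow> bool" where
  "periodic_orbit E C \<longleftrightarrow> (\<exists>\<Gamma> T. parametrizes E \<Gamma> T C)"

definition limit_cycle :: "engine \<Rightarrow> (complex \<times> real) set \<Rightarrow> bool" where
  "limit_cycle E C \<longleftrightarrow> periodic_orbit E C \<and>
     (\<exists>W. open W \<and> C \<subseteq> W \<and> (\<forall>D. periodic_orbit E D \<and> D \<subseteq> W \<longrightarrow> D = C))"

definition contractible_loop :: "(real \<Rightarrow> complex \<times> real) \<Rightarrow> real \<Rightarrow> bool" where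
  "contractible_loop \<Gamma> T \<longleftrightarrow> (\<exists>\<gamma>\<in>cylinder.
     homotopic_with_canon (\<lambda>g. g 0 = g T) {0..T} cylinder \<Gamma> (\<lambda>t. \<gamma>))"

text \<open>Parametrizations of an orbit differ only by a shift of time, so it does not matter which
  one is tested for contractibility.\<close>

definition contractible_orbit :: "engine \<Rightarrow> (complex \<times> real) set \<Rightarrow> bool" where
  "contractible_orbit E C \<longleftrightarrow> (\<exists>\<Gamma> T. parametrizes E \<Gamma> T C \<and> contractible_loop \<Gamma> T)"

definition rotational_limit_cycle :: "engine \<Rightarrow> (complex \<times> real) set \<Rightarrow> bool" where
  "rotational_limit_cycle E C \<longleftrightarrow> limit_cycle E C \<and> \<not> contractible_orbit E C"

definition graph_over_circle :: "(real \<Rightarrow> real) \<Rightarrow> (complex \<times> real) set" where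
  "graph_over_circle z = (\<lambda>q. (cis q, z q)) ` {0..<2 * pi}"

definition positive_sign :: "(complex \<times> real) set \<Rightarrow> bool" where
  "positive_sign C \<longleftrightarrow> (\<exists>z. C = graph_over_circle z \<and> (\<forall>q\<in>{0..<2 * pi}. z q > 0))"

definition negative_sign :: "(complex \<times> real) set \<Rightarrow> bool" where
  "negative_sign C \<longleftrightarrow> (\<exists>z. C = graph_over_circle z \<and> (\<forall>q\<in>{0..<2 * pi}. z q < 0))"

definition sign_definite :: "(complex \<times> real) set \<Rightarrow> bool" where
  "sign_definite C \<longleftrightarrow> positive_sign C \<or> negative_sign C"

end

theory Submission imports Defs begin

text \<open>
  The proof rests on three properties of the torque \<open>\<tau>\<close>: it is differentiable, it is \<open>2 * pi\<close>-periodic,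
  and \<open>U\<close> is an antiderivative of \<open>- \<tau>\<close>. The locale \<open>damped_rotor\<close> isolates them. Lift a
  periodic orbit to a real angle \<open>q\<close> and extend it to all times; during one period the angle
  advances by \<open>2 * pi * n\<close> for some integer \<open>n\<close>. If \<open>n = 0\<close>, the lifted curve is a loop in the
  plane, and the straight-line homotopy to a point descends to the cylinder. So a
  non-contractible orbit has \<open>n \<noteq> 0\<close>, and the reflection \<open>q \<mapsto> - q\<close>, which turns the rotor into
  another one, reduces everything to \<open>n > 0\<close>.

  Two conclusions come from the energy \<open>I * v\<^sup>2 / 2 + U q\<close>, whose derivative is \<open>- k * v\<^sup>2\<close>. If the
  rotor ever moved backwards, its angle would have a local maximum, where the energy is purely
  potential; since the angle eventually grows beyond every bound, that angle is reached again
  later, with at least the same energy, although energy has been lost in between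
  (\<open>rotation_velocity_nonneg\<close>). A velocity that is nonnegative and vanishes at some instant has a
  minimum there, so the rotor would sit at an equilibrium, which by uniqueness of solutions it
  never leaves (\<open>rotation_velocity_pos\<close>). Secondly, the velocity returns to its initial value
  after one period, so the energy lost is potential energy, and \<open>n * (U (2 * pi) - U 0) < 0\<close>
  (\<open>rotation_tilts_potential\<close>). This fixes the direction of rotation by the sign of
  \<open>U (2 * pi)\<close>, and all rotations have the same direction.

  As \<open>v > 0\<close>, the orbit is the graph of a velocity profile \<open>V\<close> over the angle. For two
  profiles \<open>V1\<close>, \<open>V2\<close> the difference \<open>H\<close> of the kinetic energies satisfies
  \<open>H' = - k * (V1 - V2)\<close>, which has the sign opposite to \<open>H\<close>; so \<open>H\<^sup>2\<close> decreases strictly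
  wherever it is not zero, and a common period forces \<open>H = 0\<close>
  (\<open>profiles_with_common_period_eq\<close>). Comparing \<open>V\<close> with its own shift by \<open>2 * pi\<close> shows that a
  profile which closes up after \<open>n\<close> turns closes up after one; comparing the profiles of two
  cycles shows that the cycles coincide.
\<close>

section \<open>Quasi-periodic functions on the line\<close>

lemma shift_by_int_multiple:
  fixes f :: "real \<Rightarrow> real"
  assumes step: "\<And>x. f (x + p) = f x + c"
  shows "f (x + of_int m * p) = f x + of_int m * c"
proof -
  have nat_case: "f (x + real j * p) = f x + real j * c" for x j
  proof (induction j)
    case (Suc j)
    have "x + real (Suc j) * p = (x + real j * p) + p" by (simp add: algebra_simps)
    then show ?case using step[of "x + real j * p"] Suc by (simp add: algebra_simps)
  qed simp
  show ?thesis
  proof (cases "m \<ge> 0")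
    case True
    then show ?thesis using nat_case[of x "nat m"] by simp
  next
    case False
    then show ?thesis using nat_case[of "x + of_int m * p" "nat (- m)"] by simp
  qed
qed

text \<open>The constant \<open>c\<close> is the increment per period: for the velocity it is 0, for the lifted angle it
  is the total turning angle.\<close>

definition extend :: "real \<Rightarrow> real \<Rightarrow> (real \<Rightarrow> real) \<Rightarrow> real \<Rightarrow> real" where
  "extend T c f t = f (t - T * of_int \<lfloor>t / T\<rfloor>) + c * of_int \<lfloor>t / T\<rfloor>"

text \<open>The clause for the closed interval, rather than the half-open one, is what makes the two
  one-sided derivatives at a joint \<open>m * T\<close> accessible.\<close>

lemma extend_on_piece:
  assumes "T > 0" "f T = f 0 + c" "of_int m * T \<le> t" "t \<le> (of_int m + 1) * T"
  shows "extend T c f t = f (t - T * of_int m) + c * of_int m"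
proof (cases "t = (of_int m + 1) * T")
  case True
  then have "t / T = of_int (m + 1)" using assms(1) by simp
  then have fl: "\<lfloor>t / T\<rfloor> = m + 1" by (metis floor_of_int)
  have "t - T * of_int (m + 1) = 0" "t - T * of_int m = T"
    using True by (simp_all add: algebra_simps)
  then show ?thesis unfolding extend_def fl using assms(2) by (simp add: algebra_simps)
next
  case False
  then have "t < (of_int m + 1) * T" using assms by simp
  then have "\<lfloor>t / T\<rfloor> = m" using assms by (simp add: floor_eq_iff field_simps)
  then show ?thesis unfolding extend_def by simp
qed

lemma extend_on_period:
  assumes "T > 0" "f T = f 0 + c" "t \<in> {0..T}"
  shows "extend T c f t = f t"
  using extend_on_piece[of T f c 0 t] assms by simp

lemma extend_shift:
  assumes "T > 0"
  shows "extend T c f (t + T) = extend T c f t + c"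
proof -
  have "(t + T) / T = t / T + 1" using assms by (simp add: field_simps)
  then have "\<lfloor>(t + T) / T\<rfloor> = \<lfloor>t / T\<rfloor> + 1" by simp
  then show ?thesis unfolding extend_def by (simp add: algebra_simps)
qed

text \<open>Inside a piece the extension is a translate of \<open>f\<close>. At a joint the derivatives from the left
  and from the right are \<open>g T\<close> and \<open>g 0\<close>, so it is the periodicity of \<open>g\<close> that makes the
  extension differentiable there.\<close>

lemma DERIV_extend:
  assumes T: "T > 0" and f: "f T = f 0 + c" and g: "g T = g 0"
    and D: "\<And>t. t \<in> {0..T} \<Longrightarrow> (f has_real_derivative g t) (at t within {0..T})"
  shows "(extend T c f has_real_derivative extend T 0 g t) (at t)"
proof -
  define piece where "piece m = {of_int m * T..(of_int m + 1) * T}" for m :: int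
  have on_piece: "(extend T c f has_real_derivative extend T 0 g s) (at s within piece m)"
    if s: "s \<in> piece m" for s m
  proof -
    have img: "(\<lambda>u. u - T * of_int m) ` piece m \<subseteq> {0..T}"
      unfolding piece_def by (auto simp: algebra_simps)
    have "s - T * of_int m \<in> {0..T}" using img s by blast
    from D[OF this]
    have "(f has_real_derivative g (s - T * of_int m))
        (at (s - T * of_int m) within (\<lambda>u. u - T * of_int m) ` piece m)"
      using img by (rule DERIV_subset)
    moreover have "((\<lambda>u. u - T * of_int m) has_real_derivative 1) (at s within piece m)"
      by (auto intro!: derivative_eq_intros)
    ultimately have "((f \<circ> (\<lambda>u. u - T * of_int m)) has_real_derivative g (s - T * of_int m) * 1)
        (at s within piece m)"
      by (rule DERIV_image_chain)
    then have "((\<lambda>u. f (u - T * of_int m) + c * of_int m) has_real_derivative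
        g (s - T * of_int m)) (at s within piece m)"
      by (auto simp: o_def intro!: derivative_eq_intros)
    then have "(extend T c f has_real_derivative g (s - T * of_int m)) (at s within piece m)"
    proof (rule has_field_derivative_transform_within[of _ _ _ _ 1])
      fix u assume "u \<in> piece m"
      then show "f (u - T * of_int m) + c * of_int m = extend T c f u"
        using extend_on_piece[of T f c m u] T f unfolding piece_def by simp
    qed (use s in auto)
    moreover have "extend T 0 g s = g (s - T * of_int m)"
      using extend_on_piece[of T g 0 m s] T g s unfolding piece_def by simp
    ultimately show ?thesis by simp
  qed
  define m where "m = \<lfloor>t / T\<rfloor>"
  have m: "of_int m * T \<le> t" "t < (of_int m + 1) * T"
    using floor_divide_lower[OF T, of t] floor_divide_upper[OF T, of t] unfolding m_def by auto
  show ?thesis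
  proof (cases "t = of_int m * T")
    case False
    have "t \<in> interior (piece m)" using m False unfolding piece_def by simp
    moreover have "t \<in> piece m" using m unfolding piece_def by simp
    ultimately show ?thesis using on_piece[of t m] at_within_interior[of t "piece m"] by simp
  next
    case True
    have in_both: "t \<in> piece m" "t \<in> piece (m - 1)"
      unfolding piece_def True using T by (simp_all add: mult_right_mono)
    have lt: "(of_int m - 1) * T < t" "t < (of_int m + 1) * T"
      unfolding True using T by simp_all
    have "piece (m - 1) \<union> piece m = {(of_int m - 1) * T..t} \<union> {t..(of_int m + 1) * T}"
      unfolding piece_def True by (simp only: of_int_diff of_int_1 diff_add_cancel)
    also have "\<dots> = {(of_int m - 1) * T..(of_int m + 1) * T}"
      using lt by (intro ivl_disj_un_two_touch) auto
    finally have "t \<in> interior (piece (m - 1) \<union> piece m)" using lt by simp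
    then have "at t = at t within (piece (m - 1) \<union> piece m)"
      by (rule at_within_interior[symmetric])
    also have "\<dots> = sup (at t within piece (m - 1)) (at t within piece m)" by (rule at_within_union)
    finally have split: "at t = sup (at t within piece (m - 1)) (at t within piece m)" .
    show ?thesis
      using on_piece[OF in_both(1)] on_piece[OF in_both(2)]
      unfolding has_field_derivative_iff unfolding split by (intro filterlim_sup)
  qed
qed

section \<open>A Gronwall estimate\<close>

text \<open>Multiplying by \<open>exp (- K * t)\<close> or \<open>exp (K * t)\<close> turns the bound into monotonicity, which
  carries the zero forward or backward in time respectively.\<close>

lemma vanishes_if_derivative_dominated:
  fixes W W' :: "real \<Rightarrow> real"
  assumes D: "\<And>t. (W has_real_derivative W' t) (at t)"
    and bound: "\<And>t. \<bar>W' t\<bar> \<le> K * W t" and nonneg: "\<And>t. 0 \<le> W t" and zero: "W t0 = 0"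
  shows "W t = 0"
proof (cases "t0 \<le> t")
  case True
  have "W t * exp (- K * t) \<le> W t0 * exp (- K * t0)"
  proof (rule DERIV_nonpos_imp_nonincreasing[OF True])
    fix x
    have "((\<lambda>x. W x * exp (- K * x)) has_real_derivative (W' x - K * W x) * exp (- K * x)) (at x)"
      by (auto intro!: derivative_eq_intros D simp: algebra_simps)
    moreover have "(W' x - K * W x) * exp (- K * x) \<le> 0"
      using bound[of x] by (intro mult_nonpos_nonneg) auto
    ultimately show "\<exists>y. ((\<lambda>x. W x * exp (- K * x)) has_real_derivative y) (at x) \<and> y \<le> 0" by blast
  qed
  then show ?thesis using zero nonneg[of t] by (simp add: mult_le_0_iff not_le[symmetric])
next
  case False
  then have le: "t \<le> t0" by simp
  have "W t * exp (K * t) \<le> W t0 * exp (K * t0)"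
  proof (rule DERIV_nonneg_imp_nondecreasing[OF le])
    fix x
    have "((\<lambda>x. W x * exp (K * x)) has_real_derivative (W' x + K * W x) * exp (K * x)) (at x)"
      by (auto intro!: derivative_eq_intros D simp: algebra_simps)
    moreover have "(W' x + K * W x) * exp (K * x) \<ge> 0"
      using bound[of x] by (intro mult_nonneg_nonneg) auto
    ultimately show "\<exists>y. ((\<lambda>x. W x * exp (K * x)) has_real_derivative y) (at x) \<and> 0 \<le> y" by blast
  qed
  then show ?thesis using zero nonneg[of t] by (simp add: mult_le_0_iff not_le[symmetric])
qed

section \<open>Rotations of a damped rotor\<close>

locale damped_rotor =
  fixes I k :: real and \<tau> U :: "real \<Rightarrow> real"
  assumes I_pos: "I > 0" and k_pos: "k > 0"
    and torque_differentiable: "\<tau> field_differentiable (at x)"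
    and torque_periodic: "\<tau> (x + 2 * pi) = \<tau> x"
    and DERIV_potential: "(U has_real_derivative - \<tau> x) (at x)"
begin

text \<open>Reversing the direction of the angle exchanges clockwise and anticlockwise rotations; this
  symmetry lets the sections below treat rotations with increasing angle only.\<close>

lemma reflected: "damped_rotor I k (\<lambda>x. - \<tau> (- x)) (\<lambda>x. U (- x))"
proof
  fix x :: real
  show "(\<lambda>x. - \<tau> (- x)) field_differentiable at x"
    using torque_differentiable[of "- x"] DERIV_mirror[of \<tau> _ x]
    unfolding field_differentiable_def by (metis DERIV_minus)
  show "- \<tau> (- (x + 2 * pi)) = - \<tau> (- x)" using torque_periodic[of "- x - 2 * pi"] by simp
  show "((\<lambda>x. U (- x)) has_real_derivative - (- \<tau> (- x))) (at x)"
    using DERIV_mirror[of U "- \<tau> (- x)" x] DERIV_potential[of "- x"] by simp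
qed (use I_pos k_pos in auto)

lemma potential_shift: "U (x + 2 * pi) = U x + (U (2 * pi) - U 0)"
proof -
  have "((\<lambda>x. U (x + 2 * pi) - U x) has_real_derivative 0) (at y)" for y
    using DERIV_shift[of U "- \<tau> (y + 2 * pi)" y "2 * pi"] DERIV_potential[of "y + 2 * pi"]
      DERIV_potential[of y] torque_periodic[of y]
    by (auto intro!: derivative_eq_intros)
  from DERIV_isconst_all[of "\<lambda>x. U (x + 2 * pi) - U x" x 0] this show ?thesis by simp
qed

text \<open>Close to \<open>y\<close> the bound is differentiability; away from \<open>y\<close> it holds because the torque,
  being periodic, is bounded. It replaces a Lipschitz condition in the uniqueness argument.\<close>

lemma torque_linear_bound_at_zero:
  assumes "\<tau> y = 0"
  shows "\<exists>M. \<forall>x. \<bar>\<tau> x\<bar> \<le> M * \<bar>x - y\<bar>"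
proof -
  have cont: "continuous_on S \<tau>" for S
    using torque_differentiable field_differentiable_imp_continuous_at
    by (meson continuous_at_imp_continuous_on)
  have "compact (\<tau> ` {0..2 * pi})" by (intro compact_continuous_image cont) simp
  then obtain B where B: "\<forall>x\<in>{0..2 * pi}. \<bar>\<tau> x\<bar> \<le> B"
    by (auto dest!: compact_imp_bounded simp: bounded_iff)
  have glob: "\<bar>\<tau> x\<bar> \<le> B" for x
  proof -
    define m where "m = \<lfloor>x / (2 * pi)\<rfloor>"
    have "x + of_int (- m) * (2 * pi) \<in> {0..2 * pi}"
      using floor_divide_lower[of "2 * pi" x] floor_divide_upper[of "2 * pi" x]
      unfolding m_def by (auto simp: algebra_simps)
    moreover have "\<tau> (x + of_int (- m) * (2 * pi)) = \<tau> x"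
      using shift_by_int_multiple[of \<tau> "2 * pi" 0 x "- m"] torque_periodic by simp
    ultimately show ?thesis using B by metis
  qed
  obtain D where "(\<tau> has_real_derivative D) (at y)"
    using torque_differentiable[of y] by (auto simp: field_differentiable_def)
  then have "((\<lambda>x. \<tau> x / (x - y)) \<longlongrightarrow> D) (at y)"
    using assms by (simp add: has_field_derivative_iff)
  then have "eventually (\<lambda>x. dist (\<tau> x / (x - y)) D < 1) (at y)"
    by (rule tendstoD) simp
  then obtain d where d: "d > 0"
    "\<And>x. x \<noteq> y \<Longrightarrow> dist x y < d \<Longrightarrow> dist (\<tau> x / (x - y)) D < 1"
    by (auto simp: eventually_at)
  have "\<bar>\<tau> x\<bar> \<le> (\<bar>D\<bar> + 1 + B / d) * \<bar>x - y\<bar>" for x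
  proof -
    have B0: "B / d \<ge> 0" using glob[of 0] d(1) by (auto intro!: divide_nonneg_pos)
    consider "x = y" | "x \<noteq> y" "\<bar>x - y\<bar> < d" | "\<bar>x - y\<bar> \<ge> d" by linarith
    then show ?thesis
    proof cases
      case 1
      then show ?thesis using assms by simp
    next
      case 2
      then have "\<bar>\<tau> x / (x - y) - D\<bar> < 1" using d(2)[of x] by (simp add: dist_real_def)
      then have "\<bar>\<tau> x / (x - y)\<bar> \<le> \<bar>D\<bar> + 1 + B / d" using B0 by linarith
      then show ?thesis using 2 by (simp add: abs_divide pos_divide_le_eq)
    next
      case 3
      have "B \<le> B / d * \<bar>x - y\<bar>"
        using 3 mult_left_mono[OF 3 B0] d(1) by simp
      moreover have "0 \<le> (\<bar>D\<bar> + 1) * \<bar>x - y\<bar>" by simp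
      ultimately show ?thesis using glob[of x] distrib_right[of "\<bar>D\<bar> + 1" "B / d" "\<bar>x - y\<bar>"]
        by linarith
    qed
  qed
  then show ?thesis by blast
qed

definition motion :: "(real \<Rightarrow> real) \<Rightarrow> (real \<Rightarrow> real) \<Rightarrow> bool" where
  "motion q v \<longleftrightarrow> (\<forall>t. (q has_real_derivative v t) (at t) \<and>
     (v has_real_derivative (- k * v t + \<tau> (q t)) / I) (at t))"

text \<open>The squared distance \<open>W\<close> from the equilibrium in the phase plane satisfies \<open>\<bar>W'\<bar> \<le> K * W\<close>,
  and the Gronwall estimate applies. The constant \<open>K\<close> comes from \<open>2 * a * b \<le> a\<^sup>2 + b\<^sup>2\<close> for
  the mixed terms.\<close>

lemma motion_from_equilibrium_is_constant:
  assumes m: "motion q v" and v0: "v t0 = 0" and eq: "\<tau> (q t0) = 0"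
  shows "q t = q t0"
proof -
  obtain M where M: "\<And>x. \<bar>\<tau> x\<bar> \<le> M * \<bar>x - q t0\<bar>"
    using torque_linear_bound_at_zero[OF eq] by blast
  have M0: "M \<ge> 0" using M[of "q t0 + 1"] by simp
  define W where "W t = (q t - q t0)\<^sup>2 + (v t)\<^sup>2" for t
  define W' where
    "W' t = 2 * (q t - q t0) * v t + 2 * v t * ((- k * v t + \<tau> (q t)) / I)" for t
  have "W t = 0"
  proof (rule vanishes_if_derivative_dominated[where W = W and W' = W'
        and K = "1 + (2 * k + M) / I"])
    fix t
    show "(W has_real_derivative W' t) (at t)"
      using m unfolding motion_def W_def W'_def
      by (auto intro!: derivative_eq_intros simp: algebra_simps)
    have young: "2 * \<bar>q t - q t0\<bar> * \<bar>v t\<bar> \<le> W t"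
      using sum_squares_bound[of "\<bar>q t - q t0\<bar>" "\<bar>v t\<bar>"] unfolding W_def by simp
    have fric: "k * (v t)\<^sup>2 \<le> k * W t" using k_pos unfolding W_def by simp
    have "\<bar>2 * v t * \<tau> (q t)\<bar> \<le> 2 * \<bar>v t\<bar> * (M * \<bar>q t - q t0\<bar>)"
      using M[of "q t"] by (simp add: abs_mult mult_left_mono)
    also have "\<dots> \<le> M * W t" using mult_left_mono[OF young M0] by (simp add: algebra_simps)
    finally have tor: "\<bar>2 * v t * \<tau> (q t)\<bar> \<le> M * W t" .
    have "W' t = 2 * (q t - q t0) * v t + (- 2 * (k * (v t)\<^sup>2) + 2 * v t * \<tau> (q t)) / I"
      unfolding W'_def by (simp add: power2_eq_square algebra_simps)
    also have "\<bar>\<dots>\<bar> \<le> \<bar>2 * (q t - q t0) * v t\<bar> + \<bar>- 2 * (k * (v t)\<^sup>2) + 2 * v t * \<tau> (q t)\<bar> / I"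
      using I_pos by (intro order_trans[OF abs_triangle_ineq]) (simp add: abs_divide)
    also have "\<dots> \<le> W t + (2 * (k * W t) + M * W t) / I"
    proof (intro add_mono divide_right_mono)
      show "\<bar>2 * (q t - q t0) * v t\<bar> \<le> W t"
        using young by (simp only: abs_mult abs_numeral)
      have "k * (v t)\<^sup>2 \<ge> 0" using k_pos by simp
      then show "\<bar>- 2 * (k * (v t)\<^sup>2) + 2 * v t * \<tau> (q t)\<bar> \<le> 2 * (k * W t) + M * W t"
        using fric tor by linarith
    qed (use I_pos in simp)
    also have "\<dots> = (1 + (2 * k + M) / I) * W t" by (simp add: algebra_simps add_divide_distrib)
    finally show "\<bar>W' t\<bar> \<le> (1 + (2 * k + M) / I) * W t" .
    show "0 \<le> W t" unfolding W_def by simp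
  next
    show "W t0 = 0" using v0 unfolding W_def by simp
  qed
  then show ?thesis unfolding W_def by (simp add: sum_power2_eq_zero_iff)
qed

definition energy :: "(real \<Rightarrow> real) \<Rightarrow> (real \<Rightarrow> real) \<Rightarrow> real \<Rightarrow> real" where
  "energy q v t = I * (v t)\<^sup>2 / 2 + U (q t)"

text \<open>The work of the torque cancels against the change of the potential, and what remains is the
  power lost to friction.\<close>

lemma DERIV_energy:
  assumes "motion q v"
  shows "(energy q v has_real_derivative - k * (v t)\<^sup>2) (at t)"
proof -
  have q: "(q has_real_derivative v t) (at t)"
    and v: "(v has_real_derivative (- k * v t + \<tau> (q t)) / I) (at t)"
    using assms by (auto simp: motion_def)
  have "((\<lambda>t. U (q t)) has_real_derivative - \<tau> (q t) * v t) (at t)"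
    using DERIV_chain2[OF DERIV_potential q] .
  moreover have "((\<lambda>t. I * (v t)\<^sup>2 / 2) has_real_derivative v t * (- k * v t + \<tau> (q t))) (at t)"
    using v I_pos by (auto intro!: derivative_eq_intros)
  ultimately have "((\<lambda>t. I * (v t)\<^sup>2 / 2 + U (q t)) has_real_derivative
      v t * (- k * v t + \<tau> (q t)) + - \<tau> (q t) * v t) (at t)"
    by (rule DERIV_add[rotated])
  then show ?thesis
    unfolding energy_def[abs_def] by (simp add: algebra_simps power2_eq_square)
qed

lemma energy_antimono:
  assumes "motion q v" "s \<le> t"
  shows "energy q v t \<le> energy q v s"
  using assms(2)
proof (rule DERIV_nonpos_imp_nonincreasing)
  fix x
  show "\<exists>y. (energy q v has_real_derivative y) (at x) \<and> y \<le> 0"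
    using DERIV_energy[OF assms(1), of x] k_pos by (intro exI[of _ "- k * (v x)\<^sup>2"]) simp
qed

text \<open>The integer \<open>n\<close> counts the signed turns around the cylinder during time \<open>T\<close>.\<close>

definition rotation :: "(real \<Rightarrow> real) \<Rightarrow> (real \<Rightarrow> real) \<Rightarrow> real \<Rightarrow> int \<Rightarrow> bool" where
  "rotation q v T n \<longleftrightarrow> motion q v \<and> T > 0 \<and>
     (\<forall>t. q (t + T) = q t + 2 * pi * of_int n) \<and> (\<forall>t. v (t + T) = v t)"

lemma rotation_angle_unbounded:
  assumes r: "rotation q v T n" and n: "n > 0"
  obtains s u where "s < t" "q s < b" "t < u" "b < q u"
proof -
  obtain N :: nat where N: "\<bar>q t\<bar> + \<bar>b\<bar> < real N" using reals_Archimedean2 by blast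
  define m where "m = int N + 1"
  have shift: "q (t + of_int j * T) = q t + of_int j * (2 * pi * of_int n)" for j
    using shift_by_int_multiple[of q T "2 * pi * of_int n" t j] r by (simp add: rotation_def)
  have "1 * 1 \<le> (2 * pi) * real_of_int n" using n pi_gt3 by (intro mult_mono) auto
  then have "real_of_int m * 1 \<le> of_int m * (2 * pi * of_int n)"
    unfolding m_def by (intro mult_left_mono) auto
  moreover have "\<bar>q t\<bar> + \<bar>b\<bar> < of_int m" using N unfolding m_def by simp
  ultimately have big: "\<bar>q t\<bar> + \<bar>b\<bar> < of_int m * (2 * pi * of_int n)" by linarith
  have "0 < of_int m * T" using r unfolding m_def rotation_def by simp
  then show ?thesis
    using shift[of m] shift[of "- m"] big
    by (intro that[of "t + of_int (- m) * T" "t + of_int m * T"]) simp_all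
qed

text \<open>If the velocity were negative somewhere, the angle would have an interior maximum, at a time
  \<open>t0\<close> with velocity zero. The same angle occurs again at a later time \<open>t3\<close>. The potential energy
  is then the same and the kinetic energy is at least as large, while the motion in
  between has dissipated energy.\<close>

lemma rotation_velocity_nonneg:
  assumes r: "rotation q v T n" and n: "n > 0"
  shows "v t1 \<ge> 0"
proof (rule ccontr)
  assume "\<not> v t1 \<ge> 0"
  have mot: "motion q v" and Dq: "\<And>t. (q has_real_derivative v t) (at t)"
    using r by (auto simp: rotation_def motion_def)
  have cont: "continuous_on S q" for S
    using Dq DERIV_isCont continuous_at_imp_continuous_on by metis
  obtain d where d: "d > 0" "\<And>h. 0 < h \<Longrightarrow> h < d \<Longrightarrow> q (t1 + h) < q t1"
    using DERIV_neg_dec_right[OF Dq[of t1]] \<open>\<not> v t1 \<ge> 0\<close> by auto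
  define t2 where "t2 = t1 + d / 2"
  have t2: "t1 < t2" "q t2 < q t1" using d unfolding t2_def by auto
  obtain s where s: "s < t1" "q s < q t2" using rotation_angle_unbounded[OF r n] by metis
  \<comment> \<open>The angle peaks at \<open>t0\<close> before it falls back to \<open>q t2\<close>.\<close>
  have "\<exists>x\<in>{s..t2}. \<forall>y\<in>{s..t2}. q y \<le> q x"
    using s t2 by (intro continuous_attains_sup cont) auto
  then obtain t0 where t0: "t0 \<in> {s..t2}" and top: "\<And>y. y \<in> {s..t2} \<Longrightarrow> q y \<le> q t0" by blast
  have "q t1 \<le> q t0" using top s t2 by auto
  then have "t0 \<noteq> s" "t0 \<noteq> t2" using s t2 by auto
  then have t0: "s < t0" "t0 < t2" using t0 by auto
  have v0: "v t0 = 0"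
  proof (rule DERIV_local_max[OF Dq])
    show "0 < min (t0 - s) (t2 - t0)" using t0 by simp
    show "\<forall>y. \<bar>t0 - y\<bar> < min (t0 - s) (t2 - t0) \<longrightarrow> q y \<le> q t0"
      by (intro allI impI top) (auto simp: abs_less_iff)
  qed
  obtain u where u: "t2 < u" "q t0 < q u" using rotation_angle_unbounded[OF r n] by metis
  \<comment> \<open>The angle \<open>q t0\<close> is reached again, because the angle is unbounded.\<close>
  obtain t3 where t3: "t2 \<le> t3" "q t3 = q t0"
    using IVT'[of q t2 "q t0" u] u \<open>q t1 \<le> q t0\<close> t2 cont by force
  \<comment> \<open>Between \<open>t0\<close> and \<open>t2\<close> the angle has changed, so some energy is strictly lost there.\<close>
  obtain z where z: "t0 < z" "z < t2" "q t2 - q t0 = (t2 - t0) * v z"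
    using MVT2[OF t0(2) Dq] by blast
  have "v z \<noteq> 0" using z(3) t2 \<open>q t1 \<le> q t0\<close> by auto
  then have "- k * (v z)\<^sup>2 < 0" using k_pos by simp
  from DERIV_neg_dec_right[OF DERIV_energy[OF mot] this]
  obtain e where e: "e > 0" "\<And>h. 0 < h \<Longrightarrow> h < e \<Longrightarrow> energy q v (z + h) < energy q v z" by blast
  define h where "h = min (e / 2) (t2 - z)"
  have h: "0 < h" "h < e" "z + h \<le> t3" using e z t3 unfolding h_def by auto
  have "energy q v t3 \<le> energy q v (z + h)" using energy_antimono[OF mot h(3)] .
  also have "\<dots> < energy q v z" using e(2) h by blast
  also have "\<dots> \<le> energy q v t0" using energy_antimono[OF mot] z by simp
  finally show False using v0 t3 I_pos unfolding energy_def by (simp add: mult_less_0_iff)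
qed

text \<open>A zero of the velocity would be a minimum by the preceding lemma. Then the acceleration
  vanishes as well, so the motion would start from an equilibrium and never turn.\<close>

lemma rotation_velocity_pos:
  assumes r: "rotation q v T n" and n: "n > 0"
  shows "v t > 0"
proof (rule ccontr)
  assume "\<not> v t > 0"
  then have v0: "v t = 0" using rotation_velocity_nonneg[OF r n, of t] by simp
  have mot: "motion q v" using r by (simp add: rotation_def)
  have "(- k * v t + \<tau> (q t)) / I = 0"
  proof (rule DERIV_local_min[where d = 1 and f = v and x = t])
    show "(v has_real_derivative (- k * v t + \<tau> (q t)) / I) (at t)"
      using mot by (simp add: motion_def)
  qed (use v0 rotation_velocity_nonneg[OF r n] in auto)
  then have "\<tau> (q t) = 0" using v0 I_pos by simp
  then have "q (t + T) = q t" using motion_from_equilibrium_is_constant[OF mot v0] by blast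
  then show False using r n by (simp add: rotation_def)
qed

text \<open>The kinetic energy is periodic, so the friction losses of one period are paid by the potential,
  which changes by \<open>n * (U (2 * pi) - U 0)\<close>.\<close>

lemma rotation_tilts_potential:
  assumes r: "rotation q v T n" and n: "n > 0"
  shows "U (2 * pi) < U 0"
proof -
  have mot: "motion q v" and T: "T > 0" using r by (auto simp: rotation_def)
  have "energy q v T < energy q v 0"
  proof (rule DERIV_neg_imp_decreasing[OF T])
    fix x
    show "\<exists>y. (energy q v has_real_derivative y) (at x) \<and> y < 0"
      using DERIV_energy[OF mot, of x] rotation_velocity_pos[OF r n, of x] k_pos
      by (intro exI[of _ "- k * (v x)\<^sup>2"]) simp
  qed
  moreover have "v T = v 0" "q T = q 0 + of_int n * (2 * pi)"
    using r unfolding rotation_def by (metis add_0, metis add_0 mult.commute)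
  moreover have "U (q 0 + of_int n * (2 * pi)) = U (q 0) + of_int n * (U (2 * pi) - U 0)"
    by (rule shift_by_int_multiple[of U "2 * pi"]) (rule potential_shift)
  ultimately have "of_int n * (U (2 * pi) - U 0) < 0" unfolding energy_def by simp
  then show ?thesis using n by (simp add: mult_less_0_iff)
qed

section \<open>Velocity as a function of the angle\<close>

text \<open>The derivative is the orbit equation \<open>dv/dq = (dv/dt) / (dq/dt)\<close> in the upper half of the phase
  plane.\<close>

definition profile :: "(real \<Rightarrow> real) \<Rightarrow> bool" where
  "profile V \<longleftrightarrow> (\<forall>x. V x > 0 \<and>
     (V has_real_derivative (- k * V x + \<tau> x) / (I * V x)) (at x))"

text \<open>The difference \<open>H\<close> of the kinetic energies satisfies \<open>H' = - k * (V1 - V2)\<close>, because the torque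
  cancels. As \<open>H\<close> has the sign of \<open>V1 - V2\<close>, the periodic function \<open>H\<^sup>2\<close> is nonincreasing, and it
  is strictly decreasing at a point where the profiles differ.\<close>

lemma profiles_with_common_period_eq:
  assumes V1: "profile V1" and V2: "profile V2" and P: "P > 0"
    and p1: "\<And>x. V1 (x + P) = V1 x" and p2: "\<And>x. V2 (x + P) = V2 x"
  shows "V1 = V2"
proof (rule ext, rule ccontr)
  fix x assume neq: "V1 x \<noteq> V2 x"
  define H where "H x = I * ((V1 x)\<^sup>2 - (V2 x)\<^sup>2) / 2" for x
  have pos: "V1 y > 0" "V2 y > 0" for y using V1 V2 by (auto simp: profile_def)
  have Dsq: "((\<lambda>x. (V x)\<^sup>2) has_real_derivative 2 * (- k * V y + \<tau> y) / I) (at y)"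
    if "profile V" for V y
  proof -
    have "V y \<noteq> 0" using that unfolding profile_def by (metis less_irrefl)
    moreover have "(V has_real_derivative (- k * V y + \<tau> y) / (I * V y)) (at y)"
      using that by (simp add: profile_def)
    ultimately show ?thesis
      using I_pos by (intro DERIV_cong[OF DERIV_power[of V _ y UNIV 2]]) (auto simp: field_simps)
  qed
  have DH: "(H has_real_derivative - k * (V1 y - V2 y)) (at y)" for y
  proof -
    have "(H has_real_derivative
        I * (2 * (- k * V1 y + \<tau> y) / I - 2 * (- k * V2 y + \<tau> y) / I) / 2) (at y)"
      unfolding H_def[abs_def]
      by (intro DERIV_cdivide DERIV_cmult DERIV_diff Dsq V1 V2)
    then show ?thesis using I_pos by (simp add: algebra_simps diff_divide_distrib add_divide_distrib)
  qed
  define G where "G y = - k * I * (V1 y + V2 y) * (V1 y - V2 y)\<^sup>2" for y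
  have DG: "((\<lambda>y. (H y)\<^sup>2) has_real_derivative G y) (at y)" for y
  proof -
    have "((\<lambda>y. (H y)\<^sup>2) has_real_derivative 2 * H y * (- k * (V1 y - V2 y))) (at y)"
      using DH[of y] by (auto intro!: derivative_eq_intros)
    moreover have "2 * H y * (- k * (V1 y - V2 y)) = G y"
      unfolding G_def H_def by (simp add: power2_eq_square field_simps)
    ultimately show ?thesis by simp
  qed
  have nonpos: "G y \<le> 0" for y
    using pos[of y] k_pos I_pos unfolding G_def
    by (intro mult_nonpos_nonneg) (auto simp: mult_le_0_iff)
  have "k * I * (V1 x + V2 x) * (V1 x - V2 x)\<^sup>2 > 0"
    using pos[of x] k_pos I_pos neq by (intro mult_pos_pos) auto
  then have "G x < 0" unfolding G_def by simp
  from DERIV_neg_dec_right[OF DG this] obtain d where d: "d > 0"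
    "\<And>h. 0 < h \<Longrightarrow> h < d \<Longrightarrow> (H (x + h))\<^sup>2 < (H x)\<^sup>2" by blast
  \<comment> \<open>A step that is short enough for the strict decrease and does not overshoot the period.\<close>
  define h where "h = min (d / 2) P"
  have h: "0 < h" "h < d" "h \<le> P" using d P unfolding h_def by auto
  have "(H (x + P))\<^sup>2 \<le> (H (x + h))\<^sup>2"
    using h DG nonpos by (intro DERIV_nonpos_imp_nonincreasing[of "x + h" "x + P"]) auto
  also have "\<dots> < (H x)\<^sup>2" using d(2) h by blast
  finally show False using p1 p2 unfolding H_def by simp
qed

text \<open>The shift of a profile by one turn is a profile again, because the torque is periodic, and it
  has the same period of \<open>n\<close> turns.\<close>

lemma profile_periodic:
  assumes V: "profile V" and n: "n > 0" and p: "\<And>x. V (x + of_int n * (2 * pi)) = V x"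
  shows "V (x + 2 * pi) = V x"
proof -
  have "(\<lambda>x. V (x + 2 * pi)) = V"
  proof (rule profiles_with_common_period_eq)
    show "profile (\<lambda>x. V (x + 2 * pi))"
      using V torque_periodic DERIV_shift unfolding profile_def by metis
    show "V (x + of_int n * (2 * pi) + 2 * pi) = V (x + 2 * pi)" for x
      using p[of "x + 2 * pi"] by (simp add: algebra_simps)
  qed (use V n p in auto)
  then show ?thesis by (rule fun_cong)
qed

text \<open>As the velocity is positive, the angle is a diffeomorphism from the time line onto the
  real line; the profile is the velocity composed with its inverse.\<close>

lemma rotation_has_profile:
  assumes r: "rotation q v T n" and n: "n > 0"
  obtains V where "profile V" "\<And>x. V (x + 2 * pi) = V x"
    "range (\<lambda>t. (cis (q t), v t)) = range (\<lambda>x. (cis x, V x))"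
proof -
  have Dq: "\<And>t. (q has_real_derivative v t) (at t)"
    and Dv: "\<And>t. (v has_real_derivative (- k * v t + \<tau> (q t)) / I) (at t)"
    using r by (auto simp: rotation_def motion_def)
  note vpos = rotation_velocity_pos[OF r n]
  have cont: "continuous_on S q" for S
    using Dq DERIV_isCont continuous_at_imp_continuous_on by metis
  have incr: "q s < q t" if "s < t" for s t
    using DERIV_pos_imp_increasing[OF that] Dq vpos by blast
  then have inj: "inj q" by (intro injI) (metis less_irrefl linorder_less_linear)
  have surj: "\<exists>t. q t = x" for x
  proof -
    obtain s u where "s < 0" "q s < x" "0 < u" "x < q u"
      using rotation_angle_unbounded[OF r n] by metis
    then show ?thesis using IVT'[of q s x u] cont by force
  qed
  define g where "g = inv q"
  have qg: "q (g x) = x" for x unfolding g_def using surj by (metis f_inv_into_f rangeI)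
  have gq: "g (q t) = t" for t unfolding g_def using inj by simp
  have Dg: "(g has_real_derivative inverse (v (g x))) (at x)" for x
  proof -
    have "(g has_real_derivative inverse (v (g x))) (at (q (g x)))"
      using Dq[of "g x"] vpos[of "g x"] cont gq unfolding has_field_derivative_def
      by (intro has_derivative_inverse_strong[of UNIV "g x" q g]) (auto simp: fun_eq_iff)
    then show ?thesis by (simp add: qg)
  qed
  define V where "V x = v (g x)" for x
  have prof: "profile V"
  proof -
    have "(V has_real_derivative (- k * V x + \<tau> x) / (I * V x)) (at x)" for x
      using DERIV_chain2[OF Dv[of "g x"] Dg[of x]] unfolding V_def[abs_def]
      by (simp add: qg field_simps)
    then show ?thesis unfolding profile_def V_def using vpos by blast
  qed
  have per: "V (x + of_int n * (2 * pi)) = V x" for x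
  proof -
    have "q (g x + T) = x + of_int n * (2 * pi)"
      using r qg[of x] by (simp add: rotation_def mult.commute)
    then have "g (x + of_int n * (2 * pi)) = g x + T" using gq by metis
    then show ?thesis unfolding V_def using r by (simp add: rotation_def)
  qed
  have "range (\<lambda>t. (cis (q t), v t)) = range (\<lambda>x. (cis x, V x))"
  proof (intro equalityI image_subsetI)
    show "(cis (q t), v t) \<in> range (\<lambda>x. (cis x, V x))" for t
      by (rule range_eqI[of _ _ "q t"]) (simp add: V_def gq)
    show "(cis x, V x) \<in> range (\<lambda>t. (cis (q t), v t))" for x
      by (rule range_eqI[of _ _ "g x"]) (simp add: V_def qg)
  qed
  then show ?thesis using that[OF prof profile_periodic[OF prof n per]] by blast
qed

lemma rotation_reflected:
  assumes "rotation q v T n"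
  shows "damped_rotor.rotation I k (\<lambda>x. - \<tau> (- x)) (\<lambda>t. - q t) (\<lambda>t. - v t) T (- n)"
proof -
  interpret refl: damped_rotor I k "\<lambda>x. - \<tau> (- x)" "\<lambda>x. U (- x)" by (rule reflected)
  show ?thesis
    using assms unfolding rotation_def motion_def refl.rotation_def refl.motion_def
    by (auto intro!: derivative_eq_intros simp: minus_divide_left)
qed

end

lemma range_eq_graph_over_circle:
  assumes per: "\<And>x. V (x + 2 * pi) = V x"
  shows "range (\<lambda>x. (cis x, V x)) = graph_over_circle V"
proof
  show "graph_over_circle V \<subseteq> range (\<lambda>x. (cis x, V x))" unfolding graph_over_circle_def by blast
  show "range (\<lambda>x. (cis x, V x)) \<subseteq> graph_over_circle V"
  proof (rule image_subsetI)
    fix x :: real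
    define m where "m = \<lfloor>x / (2 * pi)\<rfloor>"
    define y where "y = x + of_int (- m) * (2 * pi)"
    have "y \<in> {0..<2 * pi}"
      using floor_divide_lower[of "2 * pi" x] floor_divide_upper[of "2 * pi" x]
      unfolding m_def y_def by (auto simp: algebra_simps)
    moreover have "V y = V x"
      using shift_by_int_multiple[of V "2 * pi" 0 x "- m"] per unfolding y_def by simp
    moreover have "cos y = cos x" "sin y = sin x"
      using shift_by_int_multiple[of cos "2 * pi" 0 x "- m"]
        shift_by_int_multiple[of sin "2 * pi" 0 x "- m"] unfolding y_def by simp_all
    then have "cis y = cis x" by (simp add: complex_eq_iff)
    ultimately show "(cis x, V x) \<in> graph_over_circle V"
      unfolding graph_over_circle_def by (intro image_eqI[of _ _ y]) simp_all
  qed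
qed

section \<open>The Stirling engine as a damped rotor\<close>

lemma rod_term_pos:
  assumes "alpha_stirling E"
  shows "(rod E)\<^sup>2 - (crank E)\<^sup>2 * (sin q)\<^sup>2 > 0"
proof -
  have c: "0 < crank E" "crank E < rod E" using assms by (auto simp: alpha_stirling_def)
  have "(crank E)\<^sup>2 * (sin q)\<^sup>2 \<le> (crank E)\<^sup>2 * 1"
    by (intro mult_left_mono) (auto simp: power_le_one_iff abs_square_le_1)
  moreover have "(crank E)\<^sup>2 < (rod E)\<^sup>2" using c by (simp add: power_strict_mono)
  ultimately show ?thesis by simp
qed

text \<open>With \<open>vmax > 2 * crank * area\<close> this upper bound keeps the volumes positive, hence the
  denominator of the pressure away from zero.\<close>

lemma pos2_le:
  assumes "alpha_stirling E"
  shows "pos2 E q \<le> crank E + rod E"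
proof -
  have c: "0 < crank E" "crank E < rod E" using assms by (auto simp: alpha_stirling_def)
  have "sqrt ((rod E)\<^sup>2 - (crank E)\<^sup>2 * (sin q)\<^sup>2) \<le> sqrt ((rod E)\<^sup>2)"
    by (rule real_sqrt_le_mono) simp
  moreover have "crank E * (- cos q) \<le> crank E * 1"
    using c cos_ge_minus_one[of q] by (intro mult_left_mono) auto
  ultimately show ?thesis using c unfolding pos2_def by simp
qed

lemma vol_pos:
  assumes E: "alpha_stirling E"
  shows "vol1 E q > 0" "vol2 E q > 0"
proof -
  have *: "A * (pos2 E q - (rod E - crank E)) < B" if "A > 0" "B > 2 * crank E * A" for A B q
    using pos2_le[OF E, of q] mult_left_mono[of "pos2 E q - (rod E - crank E)" "2 * crank E" A] that
    by (simp add: algebra_simps)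
  show "vol1 E q > 0" "vol2 E q > 0"
    using E * unfolding vol1_def vol2_def pos1_def alpha_stirling_def by auto
qed

lemma pos2_differentiable:
  assumes "alpha_stirling E"
  shows "pos2 E field_differentiable at q"
  using rod_term_pos[OF assms, of q]
  unfolding pos2_def[abs_def] field_differentiable_def
  by (intro exI) (rule derivative_eq_intros refl | simp)+

lemma phi_differentiable:
  assumes "alpha_stirling E"
  shows "phi E field_differentiable at q"
  using rod_term_pos[OF assms, of q]
  unfolding phi_def[abs_def] field_differentiable_def
  by (intro exI) (rule derivative_eq_intros refl | simp)+

lemma torque_field_differentiable:
  assumes E: "alpha_stirling E"
  shows "torque E field_differentiable at q"
proof -
  have sh: "(\<lambda>q. f (q - phase E)) field_differentiable at q"
    if "\<And>x. f field_differentiable at x" for f :: "real \<Rightarrow> real"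
    using field_differentiable_compose[of "\<lambda>q. q - phase E" q f] that
    by (simp add: o_def field_differentiable_diff)
  have vols: "vol1 E field_differentiable at q" "vol2 E field_differentiable at q"
    unfolding vol1_def[abs_def] vol2_def[abs_def] pos1_def
    by (intro field_differentiable_diff field_differentiable_mult field_differentiable_const
        sh pos2_differentiable[OF E])+
  have "vol1 E q / temp_hot E + vol2 E q / temp_cold E > 0"
    using vol_pos[OF E, of q] E by (auto simp: alpha_stirling_def intro!: add_pos_pos)
  then have "vol1 E q / temp_hot E + vol2 E q / temp_cold E \<noteq> 0" by simp
  moreover have "temp_hot E \<noteq> 0" "temp_cold E \<noteq> 0" using E by (auto simp: alpha_stirling_def)
  ultimately have "pressure E field_differentiable at q"
    unfolding pressure_def[abs_def] using vols
    by (intro field_differentiable_divide field_differentiable_add field_differentiable_const)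
  then show ?thesis
    unfolding torque_def[abs_def]
    by (intro field_differentiable_diff field_differentiable_mult field_differentiable_const
        field_differentiable_minus field_differentiable_add sh phi_differentiable[OF E])
qed

lemma torque_2pi_periodic: "torque E (q + 2 * pi) = torque E q"
proof -
  have "q + 2 * pi - phase E = (q - phase E) + 2 * pi" by simp
  then show ?thesis
    unfolding torque_def pressure_def vol1_def vol2_def pos1_def pos2_def phi_def
    by (simp only: sin_periodic cos_periodic)
qed

lemma DERIV_potential_torque:
  assumes E: "alpha_stirling E"
  shows "(potential E has_real_derivative - torque E q) (at q)"
proof -
  have cont: "continuous_on S (torque E)" for S
    using torque_field_differentiable[OF E] field_differentiable_imp_continuous_at
    by (meson continuous_at_imp_continuous_on)
  define a where "a = min 0 q - 1"
  define b where "b = max 0 q + 1"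
  have ab: "a \<le> 0" "0 \<le> b" "a < q" "q < b" unfolding a_def b_def by auto
  have "((\<lambda>u. LBINT y=0..u. torque E y) has_vector_derivative torque E q)
      (at q within {a..b})"
    using ab cont interval_integral_FTC2[of a 0 b "torque E" q] by (simp add: zero_ereal_def)
  then have "((\<lambda>u. LBINT y=0..u. torque E y) has_real_derivative torque E q) (at q)"
    using ab by (simp add: has_real_derivative_iff_has_vector_derivative at_within_Icc_at)
  then show ?thesis unfolding potential_def[abs_def] zero_ereal_def by (rule DERIV_minus)
qed

lemma stirling_damped_rotor:
  assumes E: "alpha_stirling E" and "friction E > 0"
  shows "damped_rotor (inertia E) (friction E) (torque E) (potential E)"
proof
  show "inertia E > 0" using E by (simp add: alpha_stirling_def)
qed (rule assms torque_field_differentiable torque_2pi_periodic DERIV_potential_torque E)+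

section \<open>Rotational limit cycles\<close>

text \<open>The lifted curve is closed in the plane, where it contracts linearly to a point; projecting the
  contraction by \<open>cis\<close> gives one on the cylinder.\<close>

lemma contractible_loop_if_angle_returns:
  assumes T: "T > 0" and q: "continuous_on {0..T} q" and v: "continuous_on {0..T} v"
    and \<Gamma>: "\<And>t. t \<in> {0..T} \<Longrightarrow> \<Gamma> t = (cis (q t), v t)"
    and ret: "q T = q 0" "v T = v 0"
  shows "contractible_loop \<Gamma> T"
proof -
  define h where "h = (\<lambda>(s, t). (cis ((1 - s) * q t + s * q 0), (1 - s) * v t))"
  have c: "continuous_on ({0..1} \<times> {0..T}) (\<lambda>x. q (snd x))"
    "continuous_on ({0..1} \<times> {0..T}) (\<lambda>x. v (snd x))"
    by (rule continuous_on_compose2[OF q] continuous_on_compose2[OF v],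
        auto intro!: continuous_intros)+
  have "continuous_on ({0..1} \<times> {0..T}) h"
    unfolding h_def case_prod_unfold cis_conv_exp by (intro continuous_intros c)
  moreover have "h \<in> ({0..1} \<times> {0..T}) \<rightarrow> cylinder"
    unfolding h_def cylinder_def by auto
  ultimately have "homotopic_with_canon (\<lambda>g. g 0 = g T) {0..T} cylinder \<Gamma> (\<lambda>t. (cis (q 0), 0))"
    using T ret \<Gamma>
    by (subst homotopic_with)
      (auto intro!: exI[of _ h] simp: h_def cylinder_def simp flip: subtopology_Times)
  then show ?thesis unfolding contractible_loop_def
    by (intro bexI[of _ "(cis (q 0), 0)"]) (auto simp: cylinder_def)
qed

lemma cis_eq_imp_differ_by_turns:
  assumes "cis x = cis y"
  obtains n :: int where "x = y + 2 * pi * of_int n"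
  using assms sin_cos_eq_iff[of x y] by (auto simp: complex_eq_iff)

text \<open>The parametrization over one period extends to all times. The extended angle is differentiable
  at the joints because the velocity closes up, and the extended velocity is because the
  acceleration, determined by the equation of motion, closes up too.\<close>

lemma rotational_limit_cycle_lifts_to_rotation:
  assumes E: "alpha_stirling E" and k: "friction E > 0" and C: "rotational_limit_cycle E C"
  obtains q v T n where
    "damped_rotor.rotation (inertia E) (friction E) (torque E) q v T n" "n \<noteq> 0"
    "C = range (\<lambda>t. (cis (q t), v t))"
proof -
  interpret damped_rotor "inertia E" "friction E" "torque E" "potential E"
    using stirling_damped_rotor[OF E k] .
  obtain \<Gamma> T where p: "parametrizes E \<Gamma> T C" and nc: "\<not> contractible_loop \<Gamma> T"
    using C unfolding rotational_limit_cycle_def limit_cycle_def periodic_orbit_def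
      contractible_orbit_def by blast
  have T: "T > 0" and close: "\<Gamma> 0 = \<Gamma> T" and img: "C = \<Gamma> ` {0..T}"
    and sol: "solution_on E {0..T} \<Gamma>"
    using p by (auto simp: parametrizes_def)
  obtain q v a where \<Gamma>: "\<And>t. t \<in> {0..T} \<Longrightarrow> \<Gamma> t = (cis (q t), v t)"
    and Dq: "\<And>t. t \<in> {0..T} \<Longrightarrow> (q has_real_derivative v t) (at t within {0..T})"
    and Dv: "\<And>t. t \<in> {0..T} \<Longrightarrow> (v has_real_derivative a t) (at t within {0..T})"
    and ode: "\<And>t. t \<in> {0..T} \<Longrightarrow> inertia E * a t = - friction E * v t + torque E (q t)"
    using sol unfolding solution_on_def by blast
  have "cis (q T) = cis (q 0)" and vT: "v T = v 0" using close \<Gamma>[of 0] \<Gamma>[of T] T by auto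
  then obtain n where n: "q T = q 0 + 2 * pi * of_int n"
    using cis_eq_imp_differ_by_turns by metis
  have "n \<noteq> 0"
  proof
    assume "n = 0"
    moreover have "continuous_on {0..T} q" "continuous_on {0..T} v"
      using Dq Dv by (blast intro: DERIV_continuous_on)+
    ultimately show False using contractible_loop_if_angle_returns[OF T _ _ \<Gamma>] n vT nc by simp
  qed
  have torque_turns: "torque E (x + 2 * pi * of_int m) = torque E x" for x and m :: int
    using shift_by_int_multiple[of "torque E" "2 * pi" 0 x m] torque_periodic
    by (simp add: mult.commute)
  have aT: "a T = a 0"
  proof -
    have "inertia E * a T = inertia E * a 0"
      using ode[of T] ode[of 0] T n vT torque_turns by simp
    then show ?thesis using I_pos by simp
  qed
  define Q where "Q = extend T (2 * pi * of_int n) q"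
  define W where "W = extend T 0 v"
  have DQ: "(Q has_real_derivative W t) (at t)" for t
    unfolding Q_def W_def using DERIV_extend[of T q "2 * pi * of_int n" v] T n vT Dq by simp
  have DW: "(W has_real_derivative extend T 0 a t) (at t)" for t
    unfolding W_def using DERIV_extend[of T v 0 a] T vT aT Dv by simp
  have acc: "extend T 0 a t = (- friction E * W t + torque E (Q t)) / inertia E" for t
  proof -
    define s where "s = t - T * of_int \<lfloor>t / T\<rfloor>"
    have "s \<in> {0..T}"
      using floor_divide_lower[OF T, of t] floor_divide_upper[OF T, of t]
      unfolding s_def by (auto simp: algebra_simps)
    from ode[OF this] have "a s = (- friction E * v s + torque E (q s)) / inertia E"
      using I_pos by (simp add: field_simps)
    then show ?thesis
      unfolding W_def Q_def extend_def s_def[symmetric]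
      using torque_turns[of "q s" "n * \<lfloor>t / T\<rfloor>"] by (simp add: mult.assoc)
  qed
  have rot: "rotation Q W T n"
    unfolding rotation_def motion_def
    using DQ DW acc T extend_shift[OF T] unfolding Q_def W_def by simp
  have "C = range (\<lambda>t. (cis (Q t), W t))"
  proof (intro equalityI image_subsetI)
    show "C \<subseteq> range (\<lambda>t. (cis (Q t), W t))"
    proof
      fix z assume "z \<in> C"
      then obtain t where t: "t \<in> {0..T}" "z = \<Gamma> t" using img by auto
      then have "z = (cis (Q t), W t)"
        using \<Gamma> extend_on_period[of T q "2 * pi * of_int n" t] extend_on_period[of T v 0 t] T n vT
        unfolding Q_def W_def by simp
      then show "z \<in> range (\<lambda>t. (cis (Q t), W t))" by blast
    qed
    show "(cis (Q t), W t) \<in> C" for t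
    proof -
      define m where "m = \<lfloor>t / T\<rfloor>"
      define s where "s = t - T * of_int m"
      have s: "s \<in> {0..T}"
        using floor_divide_lower[OF T, of t] floor_divide_upper[OF T, of t]
        unfolding s_def m_def by (auto simp: algebra_simps)
      have "cis (Q t) = cis (q s)" "W t = v s"
        unfolding Q_def W_def extend_def s_def m_def
        using cis_multiple_2pi[of "of_int n * of_int \<lfloor>t / T\<rfloor>"]
        by (simp_all add: cis_mult[symmetric] mult.assoc)
      then show ?thesis using \<Gamma>[OF s] img s by force
    qed
  qed
  then show ?thesis using that rot \<open>n \<noteq> 0\<close> by blast
qed

text \<open>The two cases are turning number \<open>n > 0\<close> and \<open>n < 0\<close>. In the second case the profile \<open>V\<close> belongs
  to the reflected rotor, so it appears with both argument and value negated. The inequality on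
  the potential shows that two cycles always fall into the same case.\<close>

lemma rotational_limit_cycle_dichotomy:
  assumes E: "alpha_stirling E" and k: "friction E > 0" and C: "rotational_limit_cycle E C"
  obtains (positive) V where
    "potential E (2 * pi) < potential E 0"
    "damped_rotor.profile (inertia E) (friction E) (torque E) V" "\<And>x. V (x + 2 * pi) = V x"
    "C = graph_over_circle V"
  | (negative) V where
    "potential E (2 * pi) > potential E 0"
    "damped_rotor.profile (inertia E) (friction E) (\<lambda>x. - torque E (- x)) V"
    "\<And>x. V (x + 2 * pi) = V x"
    "C = graph_over_circle (\<lambda>x. - V (- x))"
proof -
  interpret damped_rotor "inertia E" "friction E" "torque E" "potential E"
    using stirling_damped_rotor[OF E k] .
  interpret refl: damped_rotor "inertia E" "friction E" "\<lambda>x. - torque E (- x)" "\<lambda>x. potential E (- x)"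
    by (rule reflected)
  obtain q v T n where rot: "rotation q v T n" "n \<noteq> 0" and
    C': "C = range (\<lambda>t. (cis (q t), v t))"
    using rotational_limit_cycle_lifts_to_rotation[OF E k C] .
  show ?thesis
  proof (cases "n > 0")
    case True
    obtain V where V: "profile V" "\<And>x. V (x + 2 * pi) = V x"
      "range (\<lambda>t. (cis (q t), v t)) = range (\<lambda>x. (cis x, V x))"
      using rotation_has_profile[OF rot(1) True] by blast
    show ?thesis
      using positive[OF rotation_tilts_potential[OF rot(1) True] V(1,2)]
        range_eq_graph_over_circle[of V] V C' by simp
  next
    case False
    then have n: "- n > 0" using rot(2) by simp
    note rot' = rotation_reflected[OF rot(1)]
    obtain V where V: "refl.profile V" "\<And>x. V (x + 2 * pi) = V x"
      "range (\<lambda>t. (cis (- q t), - v t)) = range (\<lambda>x. (cis x, V x))"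
      using refl.rotation_has_profile[OF rot' n] by blast
    define f where "f = (\<lambda>(z, y). (cnj z, - y :: real))"
    have "C = f ` range (\<lambda>t. (cis (- q t), - v t))"
      unfolding C' f_def by (simp add: image_image cis_cnj)
    also have "\<dots> = range (\<lambda>x. (cis (- x), - V x))"
      unfolding V(3) f_def by (simp add: image_image cis_cnj)
    also have "\<dots> = (\<lambda>x. (cis (- x), - V x)) ` range uminus" by simp
    also have "\<dots> = range (\<lambda>x. (cis x, - V (- x)))" unfolding image_image by simp
    also have "\<dots> = graph_over_circle (\<lambda>x. - V (- x))"
    proof (rule range_eq_graph_over_circle)
      show "- V (- (x + 2 * pi)) = - V (- x)" for x using V(2)[of "- x - 2 * pi"] by simp
    qed
    finally have "C = graph_over_circle (\<lambda>x. - V (- x))" .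
    moreover have "potential E (2 * pi) > potential E 0"
      using refl.rotation_tilts_potential[OF rot' n] potential_shift[of "- (2 * pi)"] by simp
    ultimately show ?thesis using negative V by blast
  qed
qed

lemma graph_signs_exclusive: "\<not> (positive_sign C \<and> negative_sign C)"
proof
  assume "positive_sign C \<and> negative_sign C"
  then obtain y z where y: "C = graph_over_circle y" "\<forall>q\<in>{0..<2 * pi}. y q > 0"
    and z: "C = graph_over_circle z" "\<forall>q\<in>{0..<2 * pi}. z q < 0"
    unfolding positive_sign_def negative_sign_def by blast
  have "(cis 0, y 0) \<in> C" unfolding y(1) graph_over_circle_def by (rule imageI) simp
  then obtain x where "x \<in> {0..<2 * pi}" "y 0 = z x" unfolding z(1) graph_over_circle_def by auto
  moreover have "y 0 > 0" using y(2) by simp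
  ultimately show False using z(2) by force
qed

theorem theorem3p4:
  fixes E :: engine
  assumes "alpha_stirling E" and "friction E > 0"
  shows "(\<forall>C D. rotational_limit_cycle E C \<and> rotational_limit_cycle E D \<longrightarrow> C = D) \<and>
    (\<exists>L. (potential E \<longlongrightarrow> L) (at_left (2 * pi)) \<and>
      (\<forall>C. rotational_limit_cycle E C \<longrightarrow>
        sign_definite C \<and> (positive_sign C \<longrightarrow> L < 0) \<and> (negative_sign C \<longrightarrow> L > 0)))"
proof (intro conjI exI allI impI)
  note dichotomy = rotational_limit_cycle_dichotomy
    [OF assms, consumes 1, case_names positive negative]
  interpret damped_rotor "inertia E" "friction E" "torque E" "potential E"
    using stirling_damped_rotor[OF assms] .
  interpret refl: damped_rotor "inertia E" "friction E" "\<lambda>x. - torque E (- x)" "\<lambda>x. potential E (- x)"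
    by (rule reflected)
  have U0: "potential E 0 = 0" unfolding potential_def by (simp add: zero_ereal_def)
  show "(potential E \<longlongrightarrow> potential E (2 * pi)) (at_left (2 * pi))"
    using DERIV_isCont[OF DERIV_potential, of "2 * pi"] unfolding isCont_def
    by (rule filterlim_mono) (auto simp: at_le)
  show "C = D" if CD: "rotational_limit_cycle E C \<and> rotational_limit_cycle E D" for C D
  proof -
    from CD have C: "rotational_limit_cycle E C" and D: "rotational_limit_cycle E D" by auto
    from C show ?thesis
    proof (cases rule: dichotomy)
      case (positive V)
      note V = this
      from D show ?thesis
      proof (cases rule: dichotomy)
        case (positive V')
        then show ?thesis using V profiles_with_common_period_eq[of V V' "2 * pi"] by simp
      qed (use V in simp)
    next
      case (negative V)
      note V = this
      from D show ?thesis
      proof (cases rule: dichotomy)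
        case (negative V')
        then show ?thesis using V refl.profiles_with_common_period_eq[of V V' "2 * pi"] by simp
      qed (use V in simp)
    qed
  qed
  fix C assume C: "rotational_limit_cycle E C"
  have main: "positive_sign C \<and> potential E (2 * pi) < 0 \<or>
    negative_sign C \<and> potential E (2 * pi) > 0"
    using C
  proof (cases rule: dichotomy)
    case (positive V)
    then show ?thesis using U0 unfolding positive_sign_def profile_def by auto
  next
    case (negative V)
    then show ?thesis using U0 unfolding negative_sign_def refl.profile_def
      by (intro disjI2 conjI exI[of _ "\<lambda>x. - V (- x)"]) auto
  qed
  show "sign_definite C" using main unfolding sign_definite_def by blast
  show "potential E (2 * pi) < 0" if "positive_sign C" using main that graph_signs_exclusive by blast
  show "potential E (2 * pi) > 0" if "negative_sign C" using main that graph_signs_exclusive by blast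
qed

end
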